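(* Let $n\ge 1$, let $\gamma: I\to\mathbb{E}^3$ be a unit-speed $(n+2)$-times differentiable regular curve with Frenet frame $\{T,N,B\}$, let $1\le k\le n$, and let $\gamma_k$ be the $k$-principal direction curve of $\gamma$, with principal normal $N_k$ and unit Darboux vector $\overline{W}_k$. Suppose $\gamma$ is an $N_k$-slant helix with axis the fixed unit vector $\vec u$, so that $\langle N_k,\vec u\rangle$ is constant on $I$. Then $$\vec u=\sin\theta\,\overline{W}_k+\cos\theta\,N_k\quad\text{on } I,$$ where $\theta\in\mathbb{R}$ is the constant (signed) angle between $N_k$ and $\vec u$; that is, there is a constant $\theta\in\mathbb{R}$ with $\langle N_k,\vec u\rangle=\cos\theta$ for which this identity holds for all $s\in I$.
   Context: $I\subset\mathbb{R}$ is an interval and $\mathbb{E}^3$ is Euclidean 3-space. For a unit-speed curve with nonvanishing second derivative, the Frenet frame is $T=\gamma'$, $N=\gamma''/\|\gamma''\|$, $B=T\times N$. Principal direction curves: let $\gamma_0(s)=\int T(s)\,ds$ be the tangent direction curve of $\gamma$ (a translate of $\gamma$, with frame $T_0=T$, $N_0=N$, $B_0=B$). Recursively for $1\le k\le n$, the $k$-principal direction curve of $\gamma$ is $\gamma_k(s)=\int N_{k-1}(s)\,ds$, where $N_{k-1}$ is the principal normal vector of $\gamma_{k-1}$. It is parametrized by the same arc-length parameter $s$ as $\gamma$ and has Frenet frame $T_k=N_{k-1}$, $N_k=N_{k-1}'/\|N_{k-1}'\|$, $B_k=T_k\times N_k$. It is assumed that $\gamma''\neq 0$ everywhere, so that these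 frames exist, and that the derivatives appearing in the Frenet equations exist and that $\kappa_k,\tau_k$ are differentiable. The curvature $\kappa_k>0$ and torsion $\tau_k$ of $\gamma_k$ are defined by the Frenet equations $T_k'=\kappa_kN_k$, $N_k'=-\kappa_kT_k+\tau_kB_k$, $B_k'=-\tau_kN_k$. The Darboux vector of $\gamma_k$ is $W_k=\tau_kT_k+\kappa_kB_k$, and its unit Darboux vector is $\overline{W}_k=W_k/\|W_k\|$. The curve $\gamma$ is an $N_k$-slant helix with axis $\vec u$ if the principal normal vector $N_k$ of $\gamma_k$ makes a constant angle with the fixed unit vector $\vec u$. *)

theory Defs
  imports "HOL-Analysis.Analysis"
begin

text \<open>
  Curves are functions on the reals that matter only on the parameter interval I. All
  derivatives are taken within I, i.e. they are one-sided at end points belonging to I.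
\<close>

primrec times_differentiable_on ::
    "nat \<Rightarrow> (real \<Rightarrow> 'a::real_normed_vector) \<Rightarrow> real set \<Rightarrow> bool" where
  "times_differentiable_on 0 f I \<longleftrightarrow> True"
| "times_differentiable_on (Suc m) f I \<longleftrightarrow>
     f differentiable_on I \<and>
     times_differentiable_on m (\<lambda>s. vector_derivative f (at s within I)) I"

definition tangent :: "real set \<Rightarrow> (real \<Rightarrow> real^3) \<Rightarrow> real \<Rightarrow> real^3" where
  "tangent I \<gamma> s = vector_derivative \<gamma> (at s within I)"

text \<open>The following frame is the Frenet frame for unit-speed curves only.\<close>

definition principal_normal :: "real set \<Rightarrow> (real \<Rightarrow> real^3) \<Rightarrow> real \<Rightarrow> real^3" where
  "principal_normal I \<gamma> s =
     (let a = vector_derivative (tangent I \<gamma>) (at s within I) in a /\<^sub>R norm a)"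

definition binormal :: "real set \<Rightarrow> (real \<Rightarrow> real^3) \<Rightarrow> real \<Rightarrow> real^3" where
  "binormal I \<gamma> s = cross3 (tangent I \<gamma> s) (principal_normal I \<gamma> s)"

text \<open>The derivatives in the Frenet equations exist, and the equations hold with curvature
  \<open>\<kappa>\<close> and torsion \<open>\<tau>\<close>; this determines both functions on I.\<close>

definition frenet_equations ::
    "real set \<Rightarrow> (real \<Rightarrow> real^3) \<Rightarrow> (real \<Rightarrow> real) \<Rightarrow> (real \<Rightarrow> real) \<Rightarrow> bool" where
  "frenet_equations I \<gamma> \<kappa> \<tau> \<longleftrightarrow>
     (\<forall>s\<in>I. \<kappa> s > 0 \<and>
        (tangent I \<gamma> has_vector_derivative \<kappa> s *\<^sub>R principal_normal I \<gamma> s) (at s within I) \<and>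
        (principal_normal I \<gamma> has_vector_derivative
           - \<kappa> s *\<^sub>R tangent I \<gamma> s + \<tau> s *\<^sub>R binormal I \<gamma> s) (at s within I) \<and>
        (binormal I \<gamma> has_vector_derivative - \<tau> s *\<^sub>R principal_normal I \<gamma> s) (at s within I))"

text \<open>\<open>c k\<close> is the k-principal direction curve of \<open>\<gamma>\<close>. Each curve, being an indefinite integral,
  is determined only up to translation, so \<open>c\<close> is any family of such antiderivatives.\<close>

definition principal_direction_curves ::
    "real set \<Rightarrow> (real \<Rightarrow> real^3) \<Rightarrow> nat \<Rightarrow> (nat \<Rightarrow> real \<Rightarrow> real^3) \<Rightarrow> bool" where
  "principal_direction_curves I \<gamma> n c \<longleftrightarrow>
     (\<forall>s\<in>I. (c 0 has_vector_derivative tangent I \<gamma> s) (at s within I)) \<and>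
     (\<forall>k\<in>{1..n}. \<forall>s\<in>I.
        (c k has_vector_derivative principal_normal I (c (k - 1)) s) (at s within I))"

definition darboux ::
    "real set \<Rightarrow> (real \<Rightarrow> real^3) \<Rightarrow> (real \<Rightarrow> real) \<Rightarrow> (real \<Rightarrow> real) \<Rightarrow> real \<Rightarrow> real^3" where
  "darboux I \<gamma> \<kappa> \<tau> s = \<tau> s *\<^sub>R tangent I \<gamma> s + \<kappa> s *\<^sub>R binormal I \<gamma> s"

definition unit_darboux ::
    "real set \<Rightarrow> (real \<Rightarrow> real^3) \<Rightarrow> (real \<Rightarrow> real) \<Rightarrow> (real \<Rightarrow> real) \<Rightarrow> real \<Rightarrow> real^3" where
  "unit_darboux I \<gamma> \<kappa> \<tau> s = darboux I \<gamma> \<kappa> \<tau> s /\<^sub>R norm (darboux I \<gamma> \<kappa> \<tau> s)"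

definition vector_angle :: "'a::real_inner \<Rightarrow> 'a \<Rightarrow> real" where
  "vector_angle x y = arccos (x \<bullet> y / (norm x * norm y))"

text \<open>A curve whose principal direction curves are \<open>c\<close> is an \<open>N\<^sub>k\<close>-slant helix with axis u.\<close>

definition N_slant_helix ::
    "real set \<Rightarrow> (nat \<Rightarrow> real \<Rightarrow> real^3) \<Rightarrow> nat \<Rightarrow> real^3 \<Rightarrow> bool" where
  "N_slant_helix I c k u \<longleftrightarrow>
     norm u = 1 \<and> (\<exists>\<phi>. \<forall>s\<in>I. vector_angle (principal_normal I (c k) s) u = \<phi>)"

end

theory Submission
  imports Defs
begin

text \<open>
  Write \<open>T, N, B\<close> for the frame of the \<open>k\<close>-th principal direction curve. The derivative
  \<open>N' = - \<kappa> T + \<tau> B\<close> is orthogonal to \<open>N\<close>, and its cross product with \<open>N\<close> is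
  exactly the Darboux vector: \<open>N \<times> N' = \<tau> T + \<kappa> B = W\<close> (lemma \<open>darboux_eq_cross\<close>).
  If \<open>\<langle>N, u\<rangle>\<close> is constant then \<open>u\<close> is orthogonal to \<open>N'\<close>. Hence what remains of \<open>u\<close> after
  removing its \<open>N\<close>-component is orthogonal to both \<open>N\<close> and \<open>N'\<close>, so it is a multiple of
  \<open>W\<close>. The coefficient of \<open>u\<close> along the unit vector \<open>W / \<parallel>W\<parallel>\<close> has square
  \<open>1 - cos\<^sup>2 \<phi> = sin\<^sup>2 \<phi>\<close>; as it is continuous on an interval, its sign cannot change,
  and choosing \<open>\<theta> = \<plusminus>\<phi>\<close> accordingly gives the identity at every parameter at once.

  This argument needs \<open>T\<close> and \<open>N\<close> to be unit vectors. The Frenet equations alone do not give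
  that: the normalised acceleration has the default value \<open>0\<close> where the acceleration
  vanishes, and a constant curve satisfies the equations with \<open>T = N = B = 0\<close>. The property is inherited along the sequence of curves instead: the tangent of
  each curve is the principal normal of the previous one, and the derivative of that normal
  has the nonzero tangential component \<open>- \<kappa>\<close> (lemma \<open>principal_direction_regular\<close>).
\<close>

section \<open>Derivatives within an interval\<close>

text \<open>Derivatives within \<open>I\<close> are unique because an interval with interior has no isolated
  points.\<close>

lemma interval_at_within_neq_bot:
  fixes I :: "real set"
  assumes "is_interval I" "interior I \<noteq> {}" "s \<in> I"
  shows "at s within I \<noteq> bot"
proof -
  have "I \<noteq> {a}" for a
    using assms(2) by auto
  then have "s islimpt I"
    using connected_imp_perfect assms is_interval_connected by blast
  then show ?thesis
    by (simp add: trivial_limit_within)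
qed

lemma has_vector_derivative_within_unique:
  assumes "at s within I \<noteq> bot" "s \<in> I" "\<And>x. x \<in> I \<Longrightarrow> f x = g x"
    and "(f has_vector_derivative a) (at s within I)"
    and "(g has_vector_derivative b) (at s within I)"
  shows "a = b"
proof -
  have "(f has_vector_derivative b) (at s within I)"
    using has_vector_derivative_transform assms by blast
  then show ?thesis
    using assms(1,4) vector_derivative_within by metis
qed

lemma inner_derivative_of_constant_inner:
  assumes "at s within I \<noteq> bot" "s \<in> I"
    and "\<And>x. x \<in> I \<Longrightarrow> f x \<bullet> g x = d"
    and "(f has_vector_derivative a) (at s within I)"
    and "(g has_vector_derivative b) (at s within I)"
  shows "f s \<bullet> b + a \<bullet> g s = 0"
proof -
  have "((\<lambda>x. f x \<bullet> g x) has_vector_derivative (f s \<bullet> b + a \<bullet> g s)) (at s within I)"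
    using bounded_bilinear.has_vector_derivative[OF bounded_bilinear_inner assms(4,5)] .
  from has_vector_derivative_within_unique[OF assms(1,2) assms(3) this has_vector_derivative_const]
  show ?thesis .
qed

section \<open>Orthogonal decomposition by a cross product\<close>

text \<open>The double cross product \<open>w \<times> (v \<times> w)\<close> with \<open>w = a \<times> b\<close> is, up to the factor
  \<open>\<parallel>w\<parallel>\<^sup>2\<close>, the part of \<open>v\<close> orthogonal to
  \<open>w\<close>, and it vanishes because \<open>v \<times> w\<close> is a combination of \<open>a\<close> and \<open>b\<close> with
  coefficients \<open>\<langle>v, b\<rangle>\<close> and \<open>\<langle>v, a\<rangle>\<close>.\<close>

lemma orthogonal_to_both_imp_multiple_of_cross:
  fixes a b v :: "real^3"
  assumes "v \<bullet> a = 0" "v \<bullet> b = 0"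
  defines "w \<equiv> cross3 a b"
  shows "(w \<bullet> w) *\<^sub>R v = (w \<bullet> v) *\<^sub>R w"
proof -
  have "cross3 v w = 0"
    using assms(1,2) by (simp add: w_def Lagrange)
  then have "cross3 w (cross3 v w) = 0"
    by (simp add: cross_zero_right)
  then show ?thesis
    by (simp add: Lagrange)
qed

lemma unit_vector_decomposition:
  fixes m d u :: "real^3"
  assumes "norm m = 1" "norm u = 1" "u \<bullet> d = 0" "m \<bullet> d = 0" "cross3 m d \<noteq> 0"
  defines "w \<equiv> cross3 m d /\<^sub>R norm (cross3 m d)"
  shows "u = (u \<bullet> w) *\<^sub>R w + (m \<bullet> u) *\<^sub>R m"
    and "(u \<bullet> w)\<^sup>2 + (m \<bullet> u)\<^sup>2 = 1"
proof -
  define x where "x = cross3 m d"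
  define v where "v = u - (m \<bullet> u) *\<^sub>R m"
  have mm: "m \<bullet> m = 1" and uu: "u \<bullet> u = 1"
    using assms(1,2) by (simp_all add: norm_eq_1)
  have "v \<bullet> m = 0" "v \<bullet> d = 0"
    using mm assms(3,4) by (simp_all add: v_def inner_diff_left inner_diff_right inner_commute)
  then have vx: "(x \<bullet> x) *\<^sub>R v = (x \<bullet> v) *\<^sub>R x"
    unfolding x_def by (rule orthogonal_to_both_imp_multiple_of_cross)
  have "x \<bullet> m = 0"
    by (simp add: x_def dot_cross_self)
  then have xv: "x \<bullet> v = x \<bullet> u"
    by (simp add: v_def inner_diff_right)
  have x0: "x \<bullet> x \<noteq> 0"
    using assms(5) by (simp add: x_def)
  have "v = ((x \<bullet> u) / (x \<bullet> x)) *\<^sub>R x"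
    using arg_cong[OF vx, of "\<lambda>y. y /\<^sub>R (x \<bullet> x)"] x0 xv by (simp add: divide_inverse mult.commute)
  also have "\<dots> = (u \<bullet> w) *\<^sub>R w"
    by (simp add: w_def x_def[symmetric] dot_square_norm power2_eq_square inner_commute field_simps)
  finally show dec: "u = (u \<bullet> w) *\<^sub>R w + (m \<bullet> u) *\<^sub>R m"
    by (simp add: v_def algebra_simps)
  have "u \<bullet> u = (u \<bullet> w) * (u \<bullet> w) + (m \<bullet> u) * (m \<bullet> u)"
    by (subst (2) dec) (simp add: inner_add_right inner_commute)
  then show "(u \<bullet> w)\<^sup>2 + (m \<bullet> u)\<^sup>2 = 1"
    using uu by (simp add: power2_eq_square)
qed

section \<open>Frames of the principal direction curves\<close>

lemma norm_principal_normal: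
  assumes "vector_derivative (tangent I \<gamma>) (at s within I) \<noteq> 0"
  shows "norm (principal_normal I \<gamma> s) = 1"
  using assms by (simp add: principal_normal_def Let_def)

lemma tangent_inner_principal_normal:
  assumes "at s within I \<noteq> bot" "s \<in> I" "\<forall>x\<in>I. norm (tangent I \<gamma> x) = 1"
    and "frenet_equations I \<gamma> \<kappa> \<tau>"
  shows "tangent I \<gamma> s \<bullet> principal_normal I \<gamma> s = 0"
proof -
  have d: "(tangent I \<gamma> has_vector_derivative \<kappa> s *\<^sub>R principal_normal I \<gamma> s) (at s within I)"
    and k: "\<kappa> s > 0"
    using assms(2,4) by (auto simp: frenet_equations_def)
  have "tangent I \<gamma> s \<bullet> (\<kappa> s *\<^sub>R principal_normal I \<gamma> s)
      + (\<kappa> s *\<^sub>R principal_normal I \<gamma> s) \<bullet> tangent I \<gamma> s = 0"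
    using assms(3)
    by (intro inner_derivative_of_constant_inner[OF assms(1,2) _ d d, of 1]) (simp add: norm_eq_1)
  then show ?thesis
    using k by (simp add: inner_commute)
qed

text \<open>Each step of the induction passes from the frame of \<open>c j\<close> to that of \<open>c (Suc j)\<close>: the
  derivative of the normal of \<open>c j\<close>, which is the acceleration of \<open>c (Suc j)\<close>, cannot vanish
  since its inner product with the unit tangent is \<open>- \<kappa>\<close>.\<close>

lemma principal_direction_regular:
  assumes "is_interval I" "interior I \<noteq> {}"
    and unit: "\<forall>s\<in>I. norm (tangent I \<gamma> s) = 1"
    and acc: "\<forall>s\<in>I. vector_derivative (tangent I \<gamma>) (at s within I) \<noteq> 0"
    and c: "principal_direction_curves I \<gamma> n c"
    and "k \<le> n"
    and fr: "\<forall>j\<le>k. frenet_equations I (c j) (\<kappa> j) (\<tau> j)"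
    and "j \<le> k"
  shows "\<forall>s\<in>I. norm (tangent I (c j) s) = 1 \<and>
           vector_derivative (tangent I (c j)) (at s within I) \<noteq> 0"
  using \<open>j \<le> k\<close>
proof (induction j)
  case 0
  have nb: "at s within I \<noteq> bot" if "s \<in> I" for s
    using interval_at_within_neq_bot assms(1,2) that by blast
  have eq: "tangent I (c 0) s = tangent I \<gamma> s" if "s \<in> I" for s
    using c nb[OF that] that
    by (auto simp: principal_direction_curves_def tangent_def[of _ "c 0"] intro: vector_derivative_within)
  show ?case
  proof
    fix s assume s: "s \<in> I"
    have d: "(tangent I (c 0) has_vector_derivative \<kappa> 0 s *\<^sub>R principal_normal I (c 0) s) (at s within I)"
      using fr s by (auto simp: frenet_equations_def)
    then have "(tangent I \<gamma> has_vector_derivative \<kappa> 0 s *\<^sub>R principal_normal I (c 0) s) (at s within I)"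
      using has_vector_derivative_transform[OF s] eq by metis
    then have "vector_derivative (tangent I (c 0)) (at s within I) =
        vector_derivative (tangent I \<gamma>) (at s within I)"
      using d nb[OF s] vector_derivative_within by metis
    then show "norm (tangent I (c 0) s) = 1 \<and>
        vector_derivative (tangent I (c 0)) (at s within I) \<noteq> 0"
      using unit acc eq s by simp
  qed
next
  case (Suc j)
  have nb: "at s within I \<noteq> bot" if "s \<in> I" for s
    using interval_at_within_neq_bot assms(1,2) that by blast
  have IH: "norm (tangent I (c j) s) = 1"
      "vector_derivative (tangent I (c j)) (at s within I) \<noteq> 0" if "s \<in> I" for s
    using Suc that by auto
  have eq: "tangent I (c (Suc j)) s = principal_normal I (c j) s" if "s \<in> I" for s
  proof -
    have "Suc j \<in> {1..n}"
      using Suc.prems \<open>k \<le> n\<close> by simp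
    then have "(c (Suc j) has_vector_derivative principal_normal I (c j) s) (at s within I)"
      using c that unfolding principal_direction_curves_def by fastforce
    then show ?thesis
      using nb[OF that] by (simp add: tangent_def vector_derivative_within)
  qed
  show ?case
  proof
    fix s assume s: "s \<in> I"
    let ?d = "- \<kappa> j s *\<^sub>R tangent I (c j) s + \<tau> j s *\<^sub>R binormal I (c j) s"
    have pos: "\<kappa> j s > 0"
      and dN: "(principal_normal I (c j) has_vector_derivative ?d) (at s within I)"
      using fr s Suc.prems by (auto simp: frenet_equations_def)
    have "(tangent I (c (Suc j)) has_vector_derivative ?d) (at s within I)"
      using has_vector_derivative_transform[OF s _ dN] eq by metis
    then have "vector_derivative (tangent I (c (Suc j))) (at s within I) = ?d"
      using nb[OF s] by (simp add: vector_derivative_within)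
    moreover have "tangent I (c j) s \<bullet> ?d = - \<kappa> j s"
      using IH(1)[OF s] by (simp add: inner_diff_right norm_eq_1 binormal_def dot_cross_self)
    ultimately have "vector_derivative (tangent I (c (Suc j))) (at s within I) \<noteq> 0"
      using pos by auto
    then show "norm (tangent I (c (Suc j)) s) = 1 \<and>
        vector_derivative (tangent I (c (Suc j))) (at s within I) \<noteq> 0"
      using eq[OF s] norm_principal_normal[OF IH(2)[OF s]] by simp
  qed
qed

section \<open>The Darboux vector\<close>

text \<open>The second factor is \<open>N'\<close> as given by the Frenet equations. In this form the Darboux vector
  is visibly normal to the plane spanned by \<open>N\<close> and \<open>N'\<close>, which is how it enters the
  decomposition of an axis.\<close>

lemma darboux_eq_cross:
  assumes "norm (principal_normal I \<gamma> s) = 1"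
    and "tangent I \<gamma> s \<bullet> principal_normal I \<gamma> s = 0"
  shows "cross3 (principal_normal I \<gamma> s)
           (- \<kappa> s *\<^sub>R tangent I \<gamma> s + \<tau> s *\<^sub>R binormal I \<gamma> s) = darboux I \<gamma> \<kappa> \<tau> s"
proof -
  let ?T = "tangent I \<gamma> s" and ?N = "principal_normal I \<gamma> s"
  have "cross3 ?N (binormal I \<gamma> s) = ?T"
    using assms by (simp add: binormal_def Lagrange norm_eq_1 inner_commute)
  moreover have "cross3 ?N ?T = - binormal I \<gamma> s"
    unfolding binormal_def by (rule cross_skew)
  ultimately show ?thesis
    by (simp add: darboux_def Cross3.right_diff_distrib cross_mult_right)
qed

text \<open>Crossing with the tangent isolates the curvature term: \<open>W \<times> T = \<kappa> B \<times> T = \<kappa> N\<close>.\<close>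

lemma darboux_neq_0:
  assumes "norm (tangent I \<gamma> s) = 1" "norm (principal_normal I \<gamma> s) = 1"
    and "tangent I \<gamma> s \<bullet> principal_normal I \<gamma> s = 0" "\<kappa> s \<noteq> 0"
  shows "darboux I \<gamma> \<kappa> \<tau> s \<noteq> 0"
proof -
  let ?T = "tangent I \<gamma> s" and ?N = "principal_normal I \<gamma> s"
  have "cross3 ?T (binormal I \<gamma> s) = - ?N"
    using assms by (simp add: binormal_def Lagrange norm_eq_1)
  then have "cross3 ?T (darboux I \<gamma> \<kappa> \<tau> s) = - \<kappa> s *\<^sub>R ?N"
    by (simp add: darboux_def cross_add_right cross_mult_right)
  also have "\<dots> \<noteq> 0"
    using assms(2,4) by auto
  finally show ?thesis
    by auto
qed

lemma continuous_on_unit_darboux: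
  assumes "frenet_equations I \<gamma> \<kappa> \<tau>" "continuous_on I \<kappa>" "continuous_on I \<tau>"
    and "\<forall>s\<in>I. darboux I \<gamma> \<kappa> \<tau> s \<noteq> 0"
  shows "continuous_on I (unit_darboux I \<gamma> \<kappa> \<tau>)"
proof -
  have "continuous_on I (tangent I \<gamma>)" "continuous_on I (binormal I \<gamma>)"
    using assms(1) has_vector_derivative_continuous
    unfolding frenet_equations_def continuous_on_eq_continuous_within by blast+
  then have "continuous_on I (darboux I \<gamma> \<kappa> \<tau>)"
    unfolding darboux_def[abs_def] using assms(2,3) by (intro continuous_intros)
  then show ?thesis
    unfolding unit_darboux_def[abs_def] using assms(4) by (auto intro!: continuous_intros)
qed

section \<open>Axes of slant helices\<close>

lemma cos_vector_angle:
  assumes "norm x = 1" "norm y = 1"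
  shows "cos (vector_angle x y) = x \<bullet> y"
proof -
  have "\<bar>x \<bullet> y\<bar> \<le> 1"
    using Cauchy_Schwarz_ineq2[of x y] assms by simp
  then show ?thesis
    using assms by (simp add: vector_angle_def cos_arccos_abs)
qed

text \<open>A continuous image of an interval is connected, so it cannot contain both \<open>d\<close> and \<open>- d\<close>
  when they differ.\<close>

lemma constant_if_square_constant:
  fixes f :: "real \<Rightarrow> real"
  assumes "is_interval I" "continuous_on I f" "\<And>s. s \<in> I \<Longrightarrow> (f s)\<^sup>2 = d\<^sup>2"
  shows "(\<forall>s\<in>I. f s = d) \<or> (\<forall>s\<in>I. f s = - d)"
proof -
  have sub: "f ` I \<subseteq> {d, - d}"
    using assms(3) by (auto simp: power2_eq_iff)
  then have "finite (f ` I)"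
    using finite_subset by blast
  then have "f constant_on I"
    using continuous_finite_range_constant assms(1,2) is_interval_connected by blast
  then show ?thesis
    using sub unfolding constant_on_def by auto
qed

theorem theorem3:
  fixes I :: "real set" and \<gamma> :: "real \<Rightarrow> real^3" and c :: "nat \<Rightarrow> real \<Rightarrow> real^3"
    and \<kappa> \<tau> :: "nat \<Rightarrow> real \<Rightarrow> real" and n k :: nat and u :: "real^3"
  assumes "is_interval I" and "interior I \<noteq> {}"
    and "n \<ge> 1" and "1 \<le> k" and "k \<le> n"
    and "times_differentiable_on (n + 2) \<gamma> I"
    and "\<forall>s\<in>I. norm (tangent I \<gamma> s) = 1"
    and "\<forall>s\<in>I. vector_derivative (tangent I \<gamma>) (at s within I) \<noteq> 0"
    and "principal_direction_curves I \<gamma> n c"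
    and "\<forall>j\<le>k. frenet_equations I (c j) (\<kappa> j) (\<tau> j)"
    and "\<forall>j\<le>k. \<kappa> j differentiable_on I \<and> \<tau> j differentiable_on I"
    and "N_slant_helix I c k u"
  shows "\<exists>\<theta>::real. \<forall>s\<in>I.
           principal_normal I (c k) s \<bullet> u = cos \<theta> \<and>
           u = sin \<theta> *\<^sub>R unit_darboux I (c k) (\<kappa> k) (\<tau> k) s
               + cos \<theta> *\<^sub>R principal_normal I (c k) s"
proof -
  let ?T = "tangent I (c k)" and ?N = "principal_normal I (c k)" and ?B = "binormal I (c k)"
  let ?W = "unit_darboux I (c k) (\<kappa> k) (\<tau> k)"
  have fr: "frenet_equations I (c k) (\<kappa> k) (\<tau> k)"
    using assms(10) by simp
  have reg: "\<forall>s\<in>I. norm (?T s) = 1 \<and> vector_derivative ?T (at s within I) \<noteq> 0"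
    using principal_direction_regular[OF assms(1,2,7-9,5,10) order_refl] .
  then have T1: "\<forall>s\<in>I. norm (?T s) = 1" and N1: "\<And>s. s \<in> I \<Longrightarrow> norm (?N s) = 1"
    using norm_principal_normal by blast+
  have nb: "at s within I \<noteq> bot" if "s \<in> I" for s
    using interval_at_within_neq_bot[OF assms(1,2) that] .
  have TN: "?T s \<bullet> ?N s = 0" if "s \<in> I" for s
    using tangent_inner_principal_normal[OF nb[OF that] that T1 fr] .
  have W0: "darboux I (c k) (\<kappa> k) (\<tau> k) s \<noteq> 0" if s: "s \<in> I" for s
  proof -
    have "\<kappa> k s \<noteq> 0"
      using fr s by (auto simp: frenet_equations_def)
    then show ?thesis
      using darboux_neq_0 T1 N1 TN s by blast
  qed
  obtain \<phi> where u1: "norm u = 1" and "\<forall>s\<in>I. vector_angle (?N s) u = \<phi>"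
    using assms(12) by (auto simp: N_slant_helix_def)
  then have Nu: "?N s \<bullet> u = cos \<phi>" if "s \<in> I" for s
    using cos_vector_angle N1 that by metis
  have dec: "u = (u \<bullet> ?W s) *\<^sub>R ?W s + cos \<phi> *\<^sub>R ?N s"
    and sq: "(u \<bullet> ?W s)\<^sup>2 = (sin \<phi>)\<^sup>2" if s: "s \<in> I" for s
  proof -
    let ?D = "- \<kappa> k s *\<^sub>R ?T s + \<tau> k s *\<^sub>R ?B s"
    have D: "(?N has_vector_derivative ?D) (at s within I)"
      using fr s by (auto simp: frenet_equations_def)
    have "?N s \<bullet> 0 + ?D \<bullet> u = 0"
      using inner_derivative_of_constant_inner[OF nb[OF s] s Nu D has_vector_derivative_const] .
    then have uD: "u \<bullet> ?D = 0"
      by (simp add: inner_commute)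
    have ND: "?N s \<bullet> ?D = 0"
      using TN[OF s] by (simp add: inner_diff_right binormal_def dot_cross_self inner_commute)
    have W: "cross3 (?N s) ?D = darboux I (c k) (\<kappa> k) (\<tau> k) s"
      using darboux_eq_cross[OF N1[OF s] TN[OF s]] .
    note unit_vector_decomposition[OF N1[OF s] u1 uD ND, unfolded W, OF W0[OF s],
        folded unit_darboux_def, unfolded Nu[OF s]]
    then show "u = (u \<bullet> ?W s) *\<^sub>R ?W s + cos \<phi> *\<^sub>R ?N s" "(u \<bullet> ?W s)\<^sup>2 = (sin \<phi>)\<^sup>2"
      by (auto simp: sin_squared_eq)
  qed
  have "continuous_on I ?W"
    using continuous_on_unit_darboux[OF fr] W0 assms(11) differentiable_imp_continuous_on by blast
  then have "continuous_on I (\<lambda>s. u \<bullet> ?W s)"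
    by (intro continuous_intros)
  then consider "\<forall>s\<in>I. u \<bullet> ?W s = sin \<phi>" | "\<forall>s\<in>I. u \<bullet> ?W s = - sin \<phi>"
    using constant_if_square_constant[OF assms(1), of "\<lambda>s. u \<bullet> ?W s" "sin \<phi>"] sq by blast
  then show ?thesis
  proof cases
    case 1
    then show ?thesis
      using dec Nu by (intro exI[of _ \<phi>]) metis
  next
    case 2
    then show ?thesis
      using dec Nu by (intro exI[of _ "- \<phi>"]) (metis cos_minus sin_minus)
  qed
qed

end
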